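(* Let $A\in\mathbb{R}^{m\times n}$, $b\in\mathbb{R}^m$, $L\in\mathbb{R}^{k\times n}$, $\rho>0$, and for $\alpha\ge1$ let $$\mathcal{G}(\alpha)=\min_{\|x\|^2=\alpha-1}\left\{\frac{\|Ax-b\|^2}{\alpha}+\rho\|Lx\|^2\right\}.$$ Let $1\le\alpha_i<\alpha_{i+1}$, and let $(x(\alpha_i),\lambda(\alpha_i))$ and $(x(\alpha_{i+1}),\lambda(\alpha_{i+1}))$ be solutions of the KKT system (given in the context) for $\alpha=\alpha_i$ and $\alpha=\alpha_{i+1}$, respectively. Define $$c_1=\frac{\alpha_{i+1}\lambda(\alpha_{i+1})-\alpha_i\lambda(\alpha_i)}{\alpha_{i+1}-\alpha_i},\qquad c_2=\alpha_i\alpha_{i+1}\left(c_1-\frac{\mathcal{G}(\alpha_{i+1})-\mathcal{G}(\alpha_i)}{\alpha_{i+1}-\alpha_i}\right),$$ $$c_3=\frac{\alpha_{i+1}\mathcal{G}(\alpha_{i+1})-\alpha_i\mathcal{G}(\alpha_i)}{\alpha_{i+1}-\alpha_i}-c_1(\alpha_{i+1}+\alpha_i),\qquad \underline{\mathcal{G}}(\alpha)=c_1\alpha+\frac{c_2}{\alpha}+c_3.$$ If $$c_1>0,\quad c_2>0,\quad \widetilde\alpha:=\sqrt{c_2/c_1}\in(\alpha_i,\alpha_{i+1}),\qquad(\ast)$$ then $$\min_{\alpha\in[\alpha_i,\alpha_{i+1}]}\mathcal{G}(\alpha)\ \ge\ \min_{\alpha\in[\alpha_i,\alpha_{i+1}]}\underline{\mathcal{G}}(\alpha)=2\sqrt{c_1c_2}+c_3,$$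 and $\widetilde\alpha$ is the unique minimizer of $\underline{\mathcal{G}}$ over $[\alpha_i,\alpha_{i+1}]$. If $(\ast)$ does not hold, then $$\min_{\alpha\in[\alpha_i,\alpha_{i+1}]}\mathcal{G}(\alpha)=\min\{\mathcal{G}(\alpha_i),\mathcal{G}(\alpha_{i+1})\}.$$
   Context: $\|\cdot\|$ is the Euclidean norm. With $Q_\alpha=\frac1\alpha A^TA+\rho L^TL$ and $f_\alpha=\frac1\alpha A^Tb$, the KKT system for a given $\alpha$ in the unknowns $(x(\alpha),\lambda(\alpha))\in\mathbb{R}^n\times\mathbb{R}$ is $$(Q_\alpha-\lambda(\alpha)I)x(\alpha)=f_\alpha,\qquad \|x(\alpha)\|^2=\alpha-1,\qquad Q_\alpha-\lambda(\alpha)I\succeq0.$$ (For $\alpha>1$ it is known that this system is solvable and that $x(\alpha)$ is optimal in the definition of $\mathcal{G}(\alpha)$ iff it is part of such a solution.) $\mathcal{G}$ is known to be continuous on $[1,\infty)$. *)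

theory Defs
  imports "HOL-Analysis.Analysis"
begin

text \<open>\<open>has_min_on f S v\<close>: the minimum of \<open>f\<close> over \<open>S\<close> exists (is attained) and equals \<open>v\<close>.\<close>

definition has_min_on :: "('a \<Rightarrow> real) \<Rightarrow> 'a set \<Rightarrow> real \<Rightarrow> bool" where
  "has_min_on f S v \<longleftrightarrow> v \<in> f ` S \<and> (\<forall>x\<in>S. v \<le> f x)"

definition pos_semidef :: "real^'n^'n \<Rightarrow> bool" where
  "pos_semidef M \<longleftrightarrow> transpose M = M \<and> (\<forall>v. 0 \<le> v \<bullet> (M *v v))"

definition objective ::
  "real^'n^'m \<Rightarrow> real^'m \<Rightarrow> real^'n^'k \<Rightarrow> real \<Rightarrow> real \<Rightarrow> real^'n \<Rightarrow> real" where
  "objective A b L \<rho> \<alpha> x = (norm (A *v x - b))\<^sup>2 / \<alpha> + \<rho> * (norm (L *v x))\<^sup>2"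

text \<open>The definite description is only meaningful for \<open>\<alpha> \<ge> 1\<close>, where the minimum exists;
  see lemma \<open>has_min_on_G\<close>.\<close>

definition G :: "real^'n^'m \<Rightarrow> real^'m \<Rightarrow> real^'n^'k \<Rightarrow> real \<Rightarrow> real \<Rightarrow> real" where
  "G A b L \<rho> \<alpha> = (THE v. has_min_on (objective A b L \<rho> \<alpha>) {x. (norm x)\<^sup>2 = \<alpha> - 1} v)"

definition Q :: "real^'n^'m \<Rightarrow> real^'n^'k \<Rightarrow> real \<Rightarrow> real \<Rightarrow> real^'n^'n" where
  "Q A L \<rho> \<alpha> = (1 / \<alpha>) *\<^sub>R (transpose A ** A) + \<rho> *\<^sub>R (transpose L ** L)"

definition f_vec :: "real^'n^'m \<Rightarrow> real^'m \<Rightarrow> real \<Rightarrow> real^'n" where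
  "f_vec A b \<alpha> = (1 / \<alpha>) *\<^sub>R (transpose A *v b)"

definition KKT ::
  "real^'n^'m \<Rightarrow> real^'m \<Rightarrow> real^'n^'k \<Rightarrow> real \<Rightarrow> real \<Rightarrow> real^'n \<Rightarrow> real \<Rightarrow> bool" where
  "KKT A b L \<rho> \<alpha> x l \<longleftrightarrow>
     (Q A L \<rho> \<alpha> - l *\<^sub>R mat 1) *v x = f_vec A b \<alpha> \<and>
     (norm x)\<^sup>2 = \<alpha> - 1 \<and>
     pos_semidef (Q A L \<rho> \<alpha> - l *\<^sub>R mat 1)"

lemma has_min_on_unique: "has_min_on f S v \<Longrightarrow> has_min_on f S w \<Longrightarrow> v = w"
  unfolding has_min_on_def by (auto intro!: antisym)

lemma has_min_on_G:
  fixes A :: "real^'n^'m" and b :: "real^'m" and L :: "real^'n^'k"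
  assumes "1 \<le> \<alpha>"
  shows "has_min_on (objective A b L \<rho> \<alpha>) {x. (norm x)\<^sup>2 = \<alpha> - 1} (G A b L \<rho> \<alpha>)"
proof -
  let ?S = "{x::real^'n. (norm x)\<^sup>2 = \<alpha> - 1}"
  have S: "?S = sphere 0 (sqrt (\<alpha> - 1))"
    using assms by (auto simp: real_sqrt_unique)
  obtain x :: "real^'n" where "norm x = sqrt (\<alpha> - 1)"
    using vector_choose_size[of "sqrt (\<alpha> - 1)"] assms by auto
  then have "x \<in> ?S" using assms by simp
  then have "?S \<noteq> {}" by blast
  moreover have "compact ?S" unfolding S by simp
  moreover have "continuous_on ?S (objective A b L \<rho> \<alpha>)"
    unfolding objective_def divide_inverse by (intro continuous_intros)
  ultimately obtain x where "x \<in> ?S" "\<forall>y\<in>?S. objective A b L \<rho> \<alpha> x \<le> objective A b L \<rho> \<alpha> y"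
    using continuous_attains_inf by metis
  then have *: "has_min_on (objective A b L \<rho> \<alpha>) ?S (objective A b L \<rho> \<alpha> x)"
    unfolding has_min_on_def by blast
  show ?thesis
    unfolding G_def by (rule theI, rule *, erule has_min_on_unique[OF _ *])
qed

end

theory Submission
  imports Defs
begin

text \<open>The KKT point of \<open>\<alpha>\<close> minimizes the Lagrangian over the whole space, so with
  \<open>p = \<parallel>Ay - b\<parallel>\<^sup>2\<close>, \<open>r = \<rho>\<parallel>Ly\<parallel>\<^sup>2\<close> and \<open>\<parallel>y\<parallel>\<^sup>2 = \<beta> - 1\<close> one gets
  \<open>p + \<alpha> r \<ge> \<alpha> G(\<alpha>) + \<alpha> \<lambda>(\<alpha>) (\<beta> - \<alpha>)\<close>. Writing \<open>\<beta>\<close> as a convex combination of the two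
  endpoints and combining their inequalities with the same weights bounds \<open>\<beta> G(\<beta>)\<close> from below by
  the quadratic that agrees with it at the endpoints and has leading coefficient \<open>c\<^sub>1\<close>, that is,
  by \<open>\<beta> G\<^sub>l(\<beta>)\<close>. What remains is the elementary minimization of \<open>c\<^sub>1 \<alpha> + c\<^sub>2 / \<alpha>\<close>.\<close>

lemma G_le_objective:
  fixes A :: "real^'n^'m" and L :: "real^'n^'k"
  assumes "1 \<le> \<alpha>" and "(norm x)\<^sup>2 = \<alpha> - 1"
  shows "G A b L \<rho> \<alpha> \<le> objective A b L \<rho> \<alpha> x"
  using has_min_on_G[OF assms(1)] assms(2) unfolding has_min_on_def by blast

lemma G_attained:
  fixes A :: "real^'n^'m" and L :: "real^'n^'k"
  assumes "1 \<le> \<alpha>"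
  obtains x where "(norm x)\<^sup>2 = \<alpha> - 1" and "G A b L \<rho> \<alpha> = objective A b L \<rho> \<alpha> x"
  using has_min_on_G[OF assms, of A b L \<rho>] unfolding has_min_on_def by blast

text \<open>The minimum of \<open>G\<close> is a minimum of the objective jointly in \<open>(\<alpha>, x)\<close> over a compact set, so
  no continuity of \<open>G\<close> is needed.\<close>

lemma G_has_min_on_Icc:
  fixes A :: "real^'n^'m" and L :: "real^'n^'k"
  assumes "1 \<le> a" and "a \<le> c"
  shows "\<exists>g. has_min_on (G A b L \<rho>) {a..c} g"
proof -
  define K where "K = {(\<alpha>, x::real^'n). \<alpha> \<in> {a..c} \<and> (norm x)\<^sup>2 = \<alpha> - 1}"
  \<comment> \<open>The constraint bounds \<open>norm x\<close> by \<open>sqrt (c - 1)\<close>, so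
    \<open>K\<close> is a closed part of a compact product.\<close>
  have K: "K = ({a..c} \<times> cball 0 (sqrt (c - 1))) \<inter> {p. (norm (snd p))\<^sup>2 = fst p - 1}"
    unfolding K_def by (auto intro!: real_le_rsqrt)
  have "compact K"
    unfolding K by (intro compact_Int_closed compact_Times closed_Collect_eq continuous_intros) auto
  moreover have "K \<noteq> {}"
  proof -
    obtain x where "(norm (x::real^'n))\<^sup>2 = a - 1"
      using G_attained[OF assms(1), of A b L \<rho>] by metis
    then have "(a, x) \<in> K" using assms by (simp add: K_def)
    then show ?thesis by blast
  qed
  moreover have "continuous_on K (\<lambda>p. objective A b L \<rho> (fst p) (snd p))"
    unfolding objective_def
    by (intro continuous_intros bounded_linear.continuous_on[OF matrix_vector_mul_bounded_linear])
      (use assms in \<open>auto simp: K_def\<close>)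
  ultimately obtain \<alpha> x where \<alpha>x: "(\<alpha>, x) \<in> K"
    and min: "\<And>\<beta> y. (\<beta>, y) \<in> K \<Longrightarrow> objective A b L \<rho> \<alpha> x \<le> objective A b L \<rho> \<beta> y"
    using continuous_attains_inf[of K "\<lambda>p. objective A b L \<rho> (fst p) (snd p)"] by force
  \<comment> \<open>The first coordinate of the joint minimizer minimizes \<open>G\<close>: its
    value is at most the joint minimum, which is below every
    \<open>G A b L \<rho> \<beta>\<close>.\<close>
  have "G A b L \<rho> \<alpha> \<le> objective A b L \<rho> \<alpha> x"
    using \<alpha>x assms by (intro G_le_objective) (auto simp: K_def)
  moreover have "objective A b L \<rho> \<alpha> x \<le> G A b L \<rho> \<beta>" if "\<beta> \<in> {a..c}" for \<beta>
  proof -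
    have "1 \<le> \<beta>" using that assms by auto
    then obtain y where "(norm y)\<^sup>2 = \<beta> - 1" "G A b L \<rho> \<beta> = objective A b L \<rho> \<beta> y"
      by (rule G_attained)
    then show ?thesis using that min[of \<beta> y] by (simp add: K_def)
  qed
  ultimately have "has_min_on (G A b L \<rho>) {a..c} (G A b L \<rho> \<alpha>)"
    using \<alpha>x unfolding has_min_on_def K_def by fastforce
  then show ?thesis by blast
qed

text \<open>Expanding the squares brings out \<open>Q\<close> and \<open>f_vec\<close>, the data in
  which the KKT system is stated.\<close>

lemma objective_eq_quadratic:
  fixes A :: "real^'n^'m" and L :: "real^'n^'k"
  shows "objective A b L \<rho> \<alpha> x =
    x \<bullet> (Q A L \<rho> \<alpha> *v x) - 2 * (f_vec A b \<alpha> \<bullet> x) + (norm b)\<^sup>2 / \<alpha>"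
proof -
  have AA: "x \<bullet> ((transpose A ** A) *v x) = (norm (A *v x))\<^sup>2"
    by (simp add: matrix_vector_mul_assoc[symmetric] dot_lmul_matrix[symmetric]
        power2_norm_eq_inner transpose_matrix_vector inner_commute)
  have LL: "x \<bullet> ((transpose L ** L) *v x) = (norm (L *v x))\<^sup>2"
    by (simp add: matrix_vector_mul_assoc[symmetric] dot_lmul_matrix[symmetric]
        power2_norm_eq_inner transpose_matrix_vector inner_commute)
  have Ab: "(b v* A) \<bullet> x = b \<bullet> (A *v x)"
    by (rule dot_lmul_matrix)
  have "(norm (A *v x - b))\<^sup>2 = (norm (A *v x))\<^sup>2 - 2 * (b \<bullet> (A *v x)) + (norm b)\<^sup>2"
    by (simp add: power2_norm_eq_inner inner_diff inner_commute)
  then show ?thesis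
    unfolding objective_def Q_def f_vec_def
    by (simp add: matrix_vector_mult_add_rdistrib scaleR_matrix_vector_assoc[symmetric]
        inner_add_right AA LL Ab add_divide_distrib diff_divide_distrib)
qed

text \<open>A positive semidefinite quadratic is minimal at its stationary point, by completing the
  square.\<close>

lemma pos_semidef_quadratic_ge:
  fixes M :: "real^'n^'n"
  assumes "pos_semidef M"
  shows "x \<bullet> (M *v x) - 2 * ((M *v x) \<bullet> x) \<le> y \<bullet> (M *v y) - 2 * ((M *v x) \<bullet> y)"
proof -
  have "y \<bullet> (M *v x) = x \<bullet> (M *v y)"
    using assms unfolding pos_semidef_def
    by (metis dot_lmul_matrix inner_commute transpose_matrix_vector)
  moreover have "0 \<le> (y - x) \<bullet> (M *v (y - x))"
    using assms by (simp add: pos_semidef_def)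
  ultimately show ?thesis
    by (simp add: matrix_vector_mult_diff_distrib inner_diff inner_commute)
qed

text \<open>Subtracting \<open>l * (norm z)\<^sup>2\<close> from the objective leaves a quadratic
  with matrix \<open>?M\<close>, positive semidefinite and stationary at \<open>x\<close> by KKT.
  The two norm constraints turn the subtracted terms into
  \<open>l * (\<beta> - \<alpha>)\<close>.\<close>

lemma KKT_lagrangian_bound:
  fixes A :: "real^'n^'m" and L :: "real^'n^'k"
  assumes "1 \<le> \<alpha>" and "KKT A b L \<rho> \<alpha> x l" and "(norm y)\<^sup>2 = \<beta> - 1"
  shows "G A b L \<rho> \<alpha> + l * (\<beta> - \<alpha>) \<le> objective A b L \<rho> \<alpha> y"
proof -
  let ?M = "Q A L \<rho> \<alpha> - l *\<^sub>R mat 1"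
  have Mx: "?M *v x = f_vec A b \<alpha>" and nx: "(norm x)\<^sup>2 = \<alpha> - 1" and psd: "pos_semidef ?M"
    using assms(2) by (auto simp: KKT_def)
  have lagrangian: "objective A b L \<rho> \<alpha> z - l * (norm z)\<^sup>2 =
      z \<bullet> (?M *v z) - 2 * ((?M *v x) \<bullet> z) + (norm b)\<^sup>2 / \<alpha>" for z
    unfolding Mx objective_eq_quadratic
    by (simp add: matrix_vector_mult_diff_rdistrib scaleR_matrix_vector_assoc[symmetric]
        inner_diff_right power2_norm_eq_inner)
  have "objective A b L \<rho> \<alpha> x - l * (norm x)\<^sup>2 \<le> objective A b L \<rho> \<alpha> y - l * (norm y)\<^sup>2"
    unfolding lagrangian using pos_semidef_quadratic_ge[OF psd, of x y] by simp
  then show ?thesis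
    using G_le_objective[OF assms(1) nx, of A b L \<rho>] unfolding nx assms(3)
    by (simp add: algebra_simps)
qed

text \<open>After multiplication by \<open>\<beta>\<close> the interpolant is a quadratic with
  leading coefficient \<open>c1\<close>. The right side is its Lagrange form: the chord through the
  endpoint values plus a multiple of \<open>(\<beta> - p) * (q - \<beta>)\<close>.\<close>

lemma interpolant_eq:
  fixes p q :: real
  assumes "0 < p" and "p < q" and "0 < \<beta>"
    and c2: "c2 = p * q * (c1 - (gq - gp) / (q - p))"
    and c3: "c3 = (q * gq - p * gp) / (q - p) - c1 * (q + p)"
  shows "\<beta> * (q - p) * (c1 * \<beta> + c2 / \<beta> + c3) =
    (q - \<beta>) * (p * gp) + (\<beta> - p) * (q * gq) - c1 * (q - p) * (\<beta> - p) * (q - \<beta>)"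
proof -
  have c2': "(q - p) * c2 = p * q * (c1 * (q - p) - (gq - gp))"
    using assms by (simp add: c2 field_simps)
  have c3': "(q - p) * c3 = q * gq - p * gp - c1 * (q + p) * (q - p)"
    using assms by (simp add: c3 field_simps)
  have "\<beta> * (c1 * \<beta> + c2 / \<beta> + c3) = c1 * \<beta>\<^sup>2 + c2 + \<beta> * c3"
    using assms(3) by (simp add: distrib_left power2_eq_square)
  then have "\<beta> * (q - p) * (c1 * \<beta> + c2 / \<beta> + c3) =
      c1 * \<beta>\<^sup>2 * (q - p) + (q - p) * c2 + \<beta> * ((q - p) * c3)"
    by algebra
  also have "\<dots> = (q - \<beta>) * (p * gp) + (\<beta> - p) * (q * gq) - c1 * (q - p) * (\<beta> - p) * (q - \<beta>)"
    unfolding c2' c3' by (simp add: algebra_simps power2_eq_square)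
  finally show ?thesis .
qed

lemma G_ge_interpolant:
  fixes A :: "real^'n^'m" and L :: "real^'n^'k"
  assumes "1 \<le> p" and "p < q" and \<beta>: "\<beta> \<in> {p..q}"
    and K0: "KKT A b L \<rho> p x0 l0" and K1: "KKT A b L \<rho> q x1 l1"
    and c1: "c1 = (q * l1 - p * l0) / (q - p)"
    and c2: "c2 = p * q * (c1 - (G A b L \<rho> q - G A b L \<rho> p) / (q - p))"
    and c3: "c3 = (q * G A b L \<rho> q - p * G A b L \<rho> p) / (q - p) - c1 * (q + p)"
  shows "c1 * \<beta> + c2 / \<beta> + c3 \<le> G A b L \<rho> \<beta>"
proof -
  have pos: "1 \<le> \<beta>" "1 \<le> q" using assms by auto
  obtain y where ny: "(norm y)\<^sup>2 = \<beta> - 1" and Gy: "G A b L \<rho> \<beta> = objective A b L \<rho> \<beta> y"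
    using G_attained[OF pos(1)] .
  define P where "P = (norm (A *v y - b))\<^sup>2"
  define R where "R = \<rho> * (norm (L *v y))\<^sup>2"
  \<comment> \<open>Multiplying by \<open>a\<close> clears the denominator in the objective, so the
    right side is affine in \<open>a\<close> with \<open>P\<close> and \<open>R\<close>
    fixed.\<close>
  have scaled: "a * G A b L \<rho> a + a * l * (\<beta> - a) \<le> P + a * R"
    if "1 \<le> a" "KKT A b L \<rho> a x l" for a x l
  proof -
    have "a * (G A b L \<rho> a + l * (\<beta> - a)) \<le> a * (P / a + R)"
      using KKT_lagrangian_bound[OF that ny] that(1)
      by (intro mult_left_mono) (auto simp: objective_def P_def R_def)
    then show ?thesis using that(1) by (simp add: algebra_simps)
  qed
  have bp: "(q - \<beta>) * (p * G A b L \<rho> p + p * l0 * (\<beta> - p)) \<le> (q - \<beta>) * (P + p * R)"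
    using scaled[OF assms(1) K0] \<beta> by (intro mult_left_mono) auto
  have bq: "(\<beta> - p) * (q * G A b L \<rho> q + q * l1 * (\<beta> - q)) \<le> (\<beta> - p) * (P + q * R)"
    using scaled[OF pos(2) K1] \<beta> by (intro mult_left_mono) auto
  have c1': "c1 * (q - p) = q * l1 - p * l0" using assms(2) by (simp add: c1)
  have "\<beta> * (q - p) * (c1 * \<beta> + c2 / \<beta> + c3) =
      (q - \<beta>) * (p * G A b L \<rho> p) + (\<beta> - p) * (q * G A b L \<rho> q)
        - (q * l1 - p * l0) * (\<beta> - p) * (q - \<beta>)"
    using interpolant_eq[OF _ assms(2) _ c2 c3, of \<beta>] pos assms(1) by (simp add: c1')
  \<comment> \<open>Both multiplier terms carry the factor
    \<open>(\<beta> - p) * (q - \<beta>)\<close>, which explains the numerator of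
    \<open>c1\<close>.\<close>
  also have "\<dots> = (q - \<beta>) * (p * G A b L \<rho> p + p * l0 * (\<beta> - p))
      + (\<beta> - p) * (q * G A b L \<rho> q + q * l1 * (\<beta> - q))"
    by (simp add: algebra_simps)
  also have "\<dots> \<le> (q - \<beta>) * (P + p * R) + (\<beta> - p) * (P + q * R)"
    using bp bq by (rule add_mono)
  \<comment> \<open>The weights sum to \<open>q - p\<close> and average \<open>p\<close> and
    \<open>q\<close> to \<open>\<beta>\<close>.\<close>
  also have "\<dots> = (q - p) * (P + \<beta> * R)"
    by (simp add: algebra_simps)
  also have "\<dots> = \<beta> * (q - p) * G A b L \<rho> \<beta>"
    using pos by (simp add: Gy objective_def P_def R_def field_simps)
  finally show ?thesis using pos assms(2) by simp
qed

text \<open>Completing the square shows the minimal value and the uniqueness of the minimizer at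
  once.\<close>

lemma linear_plus_reciprocal_eq_square:
  fixes c1 c2 \<alpha> :: real
  assumes "c1 > 0" and "c2 > 0" and "\<alpha> > 0"
  shows "c1 * \<alpha> + c2 / \<alpha> = 2 * sqrt (c1 * c2) + c1 * (\<alpha> - sqrt (c2 / c1))\<^sup>2 / \<alpha>"
proof -
  have s: "(sqrt (c2 / c1))\<^sup>2 = c2 / c1" and "c1 * sqrt (c2 / c1) = sqrt (c1 * c2)"
    using assms by (auto simp: real_sqrt_divide real_sqrt_mult field_simps)
  then show ?thesis
    using assms by (simp add: power2_diff field_simps power2_eq_square)
qed

text \<open>If \<open>\<beta>\<close> violated the bound at both endpoints, then \<open>c\<^sub>1 p \<beta> < c\<^sub>2 < c\<^sub>1 q \<beta>\<close>, which forces the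
  stationary point to be interior.\<close>

lemma linear_plus_reciprocal_ge_endpoint:
  fixes c1 c2 \<beta> :: real
  assumes "0 < p" and "p < q" and \<beta>: "\<beta> \<in> {p..q}"
    and ext: "\<not> (c1 > 0 \<and> c2 > 0 \<and> sqrt (c2 / c1) \<in> {p<..<q})"
  shows "c1 * p + c2 / p \<le> c1 * \<beta> + c2 / \<beta> \<or> c1 * q + c2 / q \<le> c1 * \<beta> + c2 / \<beta>"
proof (rule ccontr)
  assume contra: "\<not> ?thesis"
  have pos: "\<beta> > 0" "q > 0" using assms by auto
  \<comment> \<open>Each difference vanishes at its own endpoint, hence the factors
    \<open>\<beta> - p\<close> and \<open>q - \<beta>\<close>; the remaining factor carries the
    sign.\<close>
  have eqp: "c1 * p + c2 / p - (c1 * \<beta> + c2 / \<beta>) = (\<beta> - p) * (c2 - c1 * p * \<beta>) / (p * \<beta>)"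
    and eqq: "c1 * q + c2 / q - (c1 * \<beta> + c2 / \<beta>) = (q - \<beta>) * (c1 * q * \<beta> - c2) / (q * \<beta>)"
    using assms(1) pos by (simp_all add: field_simps)
  have "0 < (\<beta> - p) * (c2 - c1 * p * \<beta>) / (p * \<beta>)"
    and "0 < (q - \<beta>) * (c1 * q * \<beta> - c2) / (q * \<beta>)"
    unfolding eqp[symmetric] eqq[symmetric] using contra by auto
  then have lo: "c1 * p * \<beta> < c2" and hi: "c2 < c1 * q * \<beta>"
    using assms(1) \<beta> pos by (auto simp: zero_less_divide_iff zero_less_mult_iff mult_less_0_iff)
  \<comment> \<open>Chaining \<open>lo\<close> and \<open>hi\<close> eliminates \<open>c2\<close>
    and fixes the sign of \<open>c1\<close>; \<open>lo\<close> then gives that of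
    \<open>c2\<close>.\<close>
  then have "0 < c1 * ((q - p) * \<beta>)" by (simp add: algebra_simps)
  then have c1: "c1 > 0" using assms(2) pos by (auto intro: zero_less_mult_pos2)
  then have c2: "c2 > 0" using lo assms(1) pos by (meson less_trans mult_pos_pos)
  have "p\<^sup>2 \<le> p * \<beta>" "\<beta> * q \<le> q\<^sup>2"
    using assms(1) \<beta> pos by (auto simp: power2_eq_square)
  moreover have "p * \<beta> < c2 / c1" "c2 / c1 < \<beta> * q"
    using lo hi c1 by (auto simp: field_simps)
  ultimately have "p\<^sup>2 < c2 / c1" "c2 / c1 < q\<^sup>2" by linarith+
  then have "p < sqrt (c2 / c1)" "sqrt (c2 / c1) < q"
    using pos by (auto intro: real_less_rsqrt real_less_lsqrt)
  then show False using ext c1 c2 by simp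
qed

theorem theorem8:
  fixes A :: "real^'n^'m" and b :: "real^'m" and L :: "real^'n^'k"
    and \<rho> \<alpha>\<^sub>0 \<alpha>\<^sub>1 l\<^sub>0 l\<^sub>1 c\<^sub>1 c\<^sub>2 c\<^sub>3 :: real and x\<^sub>0 x\<^sub>1 :: "real^'n" and G\<^sub>l :: "real \<Rightarrow> real"
  assumes "\<rho> > 0" and "1 \<le> \<alpha>\<^sub>0" and "\<alpha>\<^sub>0 < \<alpha>\<^sub>1"
    and "KKT A b L \<rho> \<alpha>\<^sub>0 x\<^sub>0 l\<^sub>0" and "KKT A b L \<rho> \<alpha>\<^sub>1 x\<^sub>1 l\<^sub>1"
    and "c\<^sub>1 = (\<alpha>\<^sub>1 * l\<^sub>1 - \<alpha>\<^sub>0 * l\<^sub>0) / (\<alpha>\<^sub>1 - \<alpha>\<^sub>0)"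
    and "c\<^sub>2 = \<alpha>\<^sub>0 * \<alpha>\<^sub>1 * (c\<^sub>1 - (G A b L \<rho> \<alpha>\<^sub>1 - G A b L \<rho> \<alpha>\<^sub>0) / (\<alpha>\<^sub>1 - \<alpha>\<^sub>0))"
    and "c\<^sub>3 = (\<alpha>\<^sub>1 * G A b L \<rho> \<alpha>\<^sub>1 - \<alpha>\<^sub>0 * G A b L \<rho> \<alpha>\<^sub>0) / (\<alpha>\<^sub>1 - \<alpha>\<^sub>0) - c\<^sub>1 * (\<alpha>\<^sub>1 + \<alpha>\<^sub>0)"
    and "G\<^sub>l = (\<lambda>\<alpha>. c\<^sub>1 * \<alpha> + c\<^sub>2 / \<alpha> + c\<^sub>3)"
  shows "if c\<^sub>1 > 0 \<and> c\<^sub>2 > 0 \<and> sqrt (c\<^sub>2 / c\<^sub>1) \<in> {\<alpha>\<^sub>0<..<\<alpha>\<^sub>1}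
    then (\<exists>g g\<^sub>l. has_min_on (G A b L \<rho>) {\<alpha>\<^sub>0..\<alpha>\<^sub>1} g \<and> has_min_on G\<^sub>l {\<alpha>\<^sub>0..\<alpha>\<^sub>1} g\<^sub>l \<and>
            g \<ge> g\<^sub>l \<and> g\<^sub>l = 2 * sqrt (c\<^sub>1 * c\<^sub>2) + c\<^sub>3) \<and>
         (\<forall>\<alpha>. is_arg_min G\<^sub>l (\<lambda>\<alpha>. \<alpha> \<in> {\<alpha>\<^sub>0..\<alpha>\<^sub>1}) \<alpha> \<longleftrightarrow> \<alpha> = sqrt (c\<^sub>2 / c\<^sub>1))
    else has_min_on (G A b L \<rho>) {\<alpha>\<^sub>0..\<alpha>\<^sub>1} (min (G A b L \<rho> \<alpha>\<^sub>0) (G A b L \<rho> \<alpha>\<^sub>1))"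
proof -
  let ?G = "G A b L \<rho>"
  have lower: "G\<^sub>l \<beta> \<le> ?G \<beta>" if "\<beta> \<in> {\<alpha>\<^sub>0..\<alpha>\<^sub>1}" for \<beta>
    unfolding assms(9) using G_ge_interpolant[OF assms(2,3) that assms(4-8)] .
  have pos: "0 < \<alpha>\<^sub>0" "0 < \<alpha>\<^sub>1" using assms(2,3) by auto
  show ?thesis
  proof (cases "c\<^sub>1 > 0 \<and> c\<^sub>2 > 0 \<and> sqrt (c\<^sub>2 / c\<^sub>1) \<in> {\<alpha>\<^sub>0<..<\<alpha>\<^sub>1}")
    case True
    define s where "s = sqrt (c\<^sub>2 / c\<^sub>1)"
    define v where "v = 2 * sqrt (c\<^sub>1 * c\<^sub>2) + c\<^sub>3"
    have s: "s \<in> {\<alpha>\<^sub>0..\<alpha>\<^sub>1}" using True by (auto simp: s_def)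
    have Gl: "G\<^sub>l \<beta> = v + c\<^sub>1 * (\<beta> - s)\<^sup>2 / \<beta>" if "\<beta> \<in> {\<alpha>\<^sub>0..\<alpha>\<^sub>1}" for \<beta>
      using linear_plus_reciprocal_eq_square[of c\<^sub>1 c\<^sub>2 \<beta>] True that pos
      by (auto simp: assms(9) s_def v_def)
    have Gls: "G\<^sub>l s = v" using Gl[OF s] by simp
    have strict: "v < G\<^sub>l \<beta>" if "\<beta> \<in> {\<alpha>\<^sub>0..\<alpha>\<^sub>1}" "\<beta> \<noteq> s" for \<beta>
      using Gl[OF that(1)] that True pos by auto
    then have weak: "v \<le> G\<^sub>l \<beta>" if "\<beta> \<in> {\<alpha>\<^sub>0..\<alpha>\<^sub>1}" for \<beta>
      using that Gls by (cases "\<beta> = s") (auto intro: less_imp_le)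
    obtain g where g: "has_min_on ?G {\<alpha>\<^sub>0..\<alpha>\<^sub>1} g"
      using G_has_min_on_Icc[of \<alpha>\<^sub>0 \<alpha>\<^sub>1 A b L \<rho>] assms(2,3) by auto
    \<comment> \<open>As a minimum, \<open>g\<close> is a value of \<open>G\<close> on the interval,
      so the pointwise bounds apply to it.\<close>
    then have "v \<le> g"
      using weak lower unfolding has_min_on_def by force
    moreover have "has_min_on G\<^sub>l {\<alpha>\<^sub>0..\<alpha>\<^sub>1} v"
      using weak s Gls unfolding has_min_on_def by auto
    moreover have "is_arg_min G\<^sub>l (\<lambda>\<alpha>. \<alpha> \<in> {\<alpha>\<^sub>0..\<alpha>\<^sub>1}) \<alpha> \<longleftrightarrow> \<alpha> = s" for \<alpha>
      using s Gls strict weak unfolding is_arg_min_def by (metis not_less)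
    ultimately show ?thesis
      using True g by (auto simp: s_def v_def)
  next
    case False
    \<comment> \<open>At either endpoint the product term of the Lagrange form vanishes.\<close>
    have endpoints: "G\<^sub>l \<alpha>\<^sub>0 = ?G \<alpha>\<^sub>0" "G\<^sub>l \<alpha>\<^sub>1 = ?G \<alpha>\<^sub>1"
      using interpolant_eq[OF pos(1) assms(3) _ assms(7,8), of \<alpha>\<^sub>0]
        interpolant_eq[OF pos(1) assms(3) _ assms(7,8), of \<alpha>\<^sub>1] pos assms(3)
      by (auto simp: assms(9))
    have "min (?G \<alpha>\<^sub>0) (?G \<alpha>\<^sub>1) \<le> ?G \<beta>" if "\<beta> \<in> {\<alpha>\<^sub>0..\<alpha>\<^sub>1}" for \<beta>
    proof -
      have "G\<^sub>l \<alpha>\<^sub>0 \<le> G\<^sub>l \<beta> \<or> G\<^sub>l \<alpha>\<^sub>1 \<le> G\<^sub>l \<beta>"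
        using linear_plus_reciprocal_ge_endpoint[OF pos(1) assms(3) that False]
        by (simp add: assms(9))
      then show ?thesis using lower[OF that] endpoints by linarith
    qed
    then have "has_min_on ?G {\<alpha>\<^sub>0..\<alpha>\<^sub>1} (min (?G \<alpha>\<^sub>0) (?G \<alpha>\<^sub>1))"
      using assms(3) unfolding has_min_on_def by (auto simp: min_def)
    then show ?thesis unfolding if_not_P[OF False] .
  qed
qed

end
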